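(* Let $T$ be a hyperbolic toral automorphism of $\mathbb{T}^2=\mathbb{R}^2/\mathbb{Z}^2$ and let $\{S_k\}$ be the family of all hyperbolic toral automorphisms of $\mathbb{T}^2$ such that $\dim(E_T^- \cap E_{S_k}^-) = 0$. Then $ND(T) \cap \bigcap_k D(S_k)$ is a dense, uncountable subset of $\mathbb{T}^2$.
   Context: A hyperbolic toral automorphism of $\mathbb{T}^2=\mathbb{R}^2/\mathbb{Z}^2$ is the map induced by a matrix in $GL_2(\mathbb{Z})$ with no eigenvalue of absolute value $1$. For such a map $g$, $E_g^-$ denotes the stable manifold of $g$ through the origin $\boldsymbol{0}\in\mathbb{T}^2$, i.e. the set of $y\in\mathbb{T}^2$ whose iterates $g^n(y)$ converge to $\boldsymbol{0}$ as $n\to+\infty$; it is the image in $\mathbb{T}^2$ of the contracting eigenline of the matrix. The condition $\dim(E_T^-\cap E_{S}^-)=0$ means that the contracting eigenlines of the two matrices are distinct (equivalently, $E_T^-\cap E_S^-$ is countable). For a map $f:X\to X$ of a topological space, a point $x$ has dense forward orbit if the closure of $\{f^n(x): n\ge 0\}$ is $X$, and nondense forward orbit otherwise. $D(f)$ is the set of points with dense forward orbit under $f$, and $ND(f)$ is the set of points with nondense forward orbit under $f$. *)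

theory Defs
  imports "HOL-Analysis.Analysis"
begin

definition torus_rel :: "real^2 \<Rightarrow> real^2 \<Rightarrow> bool" where
  "torus_rel x y \<longleftrightarrow> (\<forall>i. x $ i - y $ i \<in> \<int>)"

lemma equivp_torus_rel: "equivp torus_rel"
proof (rule equivpI)
  show "reflp torus_rel" by (simp add: reflp_def torus_rel_def)
  show "symp torus_rel"
    by (metis (no_types, lifting) Ints_minus minus_diff_eq sympI torus_rel_def)
  show "transp torus_rel"
    unfolding transp_def torus_rel_def
    by (metis (no_types, lifting) Ints_add add_diff_cancel_right' add_diff_eq diff_add_cancel)
qed

quotient_type torus = "real^2" / torus_rel
  morphisms torus_rep torus_proj
  by (rule equivp_torus_rel)

text \<open>The quotient topology.\<close>

instantiation torus :: topological_space
begin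

definition open_torus :: "torus set \<Rightarrow> bool" where
  "open_torus U \<longleftrightarrow> open (torus_proj -` U)"

instance
proof
  show "open (UNIV :: torus set)" by (simp add: open_torus_def)
  show "open (S \<inter> T)" if "open S" "open T" for S T :: "torus set"
    using that by (simp add: open_torus_def open_Int)
  show "open (\<Union>K)" if "\<forall>S\<in>K. open S" for K :: "torus set set"
    using that by (simp add: open_torus_def vimage_Union open_UN)
qed

end

abbreviation real_matrix :: "int^2^2 \<Rightarrow> real^2^2" where
  "real_matrix \<equiv> map_matrix of_int"

lift_definition toral_map :: "int^2^2 \<Rightarrow> torus \<Rightarrow> torus"
  is "\<lambda>A x. real_matrix A *v x"
proof -
  fix A :: "int^2^2" and x y :: "real^2"
  assume "torus_rel x y"
  then have "real_of_int (A $ i $ j) * (x $ j - y $ j) \<in> \<int>" for i j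
    by (simp add: torus_rel_def)
  then have "(\<Sum>j\<in>UNIV. real_of_int (A $ i $ j) * (x $ j - y $ j)) \<in> \<int>" for i
    by (intro Ints_sum) auto
  then show "torus_rel (real_matrix A *v x) (real_matrix A *v y)"
    by (simp add: torus_rel_def matrix_vector_mult_def right_diff_distrib sum_subtractf)
qed

definition eigenvalue_of :: "int^2^2 \<Rightarrow> complex \<Rightarrow> bool" where
  "eigenvalue_of A c \<longleftrightarrow> (\<exists>v :: complex^2. v \<noteq> 0 \<and> map_matrix of_int A *v v = c *s v)"

text \<open>Invertibility is over \<^typ>\<open>int\<close>, i.e. it expresses membership in the group
  \<open>GL\<^sub>2(\<int>)\<close>.\<close>

definition hyperbolic_matrix :: "int^2^2 \<Rightarrow> bool" where
  "hyperbolic_matrix A \<longleftrightarrow> invertible A \<and> (\<forall>c. eigenvalue_of A c \<longrightarrow> cmod c \<noteq> 1)"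

definition hyperbolic_toral_automorphism :: "(torus \<Rightarrow> torus) \<Rightarrow> bool" where
  "hyperbolic_toral_automorphism f \<longleftrightarrow> (\<exists>A. hyperbolic_matrix A \<and> f = toral_map A)"

definition stable_manifold :: "(torus \<Rightarrow> torus) \<Rightarrow> torus set" where
  "stable_manifold f = {y. (\<lambda>n. (f ^^ n) y) \<longlonglongrightarrow> torus_proj 0}"

text \<open>\<open>E\<^sub>f\<^sup>- \<inter> E\<^sub>g\<^sup>-\<close> is an immersed, in general non-closed, Lie subgroup of the torus. Its
  dimension is that of its Lie algebra, the space of all \<open>v\<close> whose one-parameter subgroup
  stays inside it. The lemma \<open>torus_dim_stable_manifolds_iff\<close> below confirms that dimension 0
  means that the contracting eigenlines are distinct.\<close>

definition torus_lie_algebra :: "torus set \<Rightarrow> (real^2) set" where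
  "torus_lie_algebra H = {v. \<forall>t::real. torus_proj (t *\<^sub>R v) \<in> H}"

definition torus_dim :: "torus set \<Rightarrow> nat" where
  "torus_dim H = dim (torus_lie_algebra H)"

definition dense_orbit_points :: "('a::topological_space \<Rightarrow> 'a) \<Rightarrow> 'a set" where
  "dense_orbit_points f = {x. closure (range (\<lambda>n. (f ^^ n) x)) = UNIV}"

definition nondense_orbit_points :: "('a::topological_space \<Rightarrow> 'a) \<Rightarrow> 'a set" where
  "nondense_orbit_points f = {x. closure (range (\<lambda>n. (f ^^ n) x)) \<noteq> UNIV}"

definition contracting_eigenline :: "int^2^2 \<Rightarrow> (real^2) set" where
  "contracting_eigenline A = {v. \<exists>c::real. \<bar>c\<bar> < 1 \<and> real_matrix A *v v = c *\<^sub>R v}"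

lemma eigenvector_2x2:
  fixes M :: "'a::field^2^2"
  assumes "c * c - (M$1$1 + M$2$2) * c + (M$1$1 * M$2$2 - M$1$2 * M$2$1) = 0"
  shows "\<exists>v. v \<noteq> 0 \<and> M *v v = c *s v"
proof -
  have eq: "M *v v = c *s v \<longleftrightarrow>
      M$1$1 * v$1 + M$1$2 * v$2 = c * v$1 \<and> M$2$1 * v$1 + M$2$2 * v$2 = c * v$2" for v
    by (simp add: vec_eq_iff forall_2 matrix_vector_mult_def sum_2)
  have nz: "v \<noteq> 0 \<longleftrightarrow> v$1 \<noteq> 0 \<or> v$2 \<noteq> 0" for v :: "'a^2"
    by (simp add: vec_eq_iff forall_2)
  consider "M$1$2 \<noteq> 0 \<or> c \<noteq> M$1$1" | "M$2$1 \<noteq> 0 \<or> c \<noteq> M$2$2"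
    | "M$1$2 = 0" "M$2$1 = 0" "c = M$1$1" "c = M$2$2" by blast
  then show ?thesis
  proof cases
    case 1
    let ?v = "vector [M$1$2, c - M$1$1] :: 'a^2"
    have "M *v ?v = c *s ?v" using assms by (simp add: eq) algebra
    moreover have "?v \<noteq> 0" using 1 by (simp add: nz)
    ultimately show ?thesis by blast
  next
    case 2
    let ?v = "vector [c - M$2$2, M$2$1] :: 'a^2"
    have "M *v ?v = c *s ?v" using assms by (simp add: eq) algebra
    moreover have "?v \<noteq> 0" using 2 by (auto simp add: nz)
    ultimately show ?thesis by blast
  next
    case 3
    let ?v = "vector [1, 0] :: 'a^2"
    have "M *v ?v = c *s ?v" unfolding eq using 3 by simp
    moreover have "?v \<noteq> 0" by (simp add: nz)
    ultimately show ?thesis by blast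
  qed
qed

lemma invertible_int_det:
  fixes A :: "int^2^2"
  assumes "invertible A"
  shows "\<bar>det A\<bar> = 1"
proof -
  obtain B where "A ** B = mat 1" using assms unfolding invertible_def by blast
  then have "det A * det B = 1" by (metis det_I det_mul)
  then show ?thesis by (metis abs_zmult_eq_1 abs_1)
qed

lemma hyperbolic_matrix_contracting_eigenvalue:
  assumes "hyperbolic_matrix A"
  defines "M \<equiv> real_matrix A"
  obtains l :: real and u where "u \<noteq> 0" "M *v u = l *s u" "\<bar>l\<bar> < 1" "\<bar>det M\<bar> = 1" "l \<noteq> 0"
proof -
  let ?C = "map_matrix of_int A :: complex^2^2"
  define t where "t = M$1$1 + M$2$2"
  define d where "d = M$1$1 * M$2$2 - M$1$2 * M$2$1"
  have dM: "det M = d" by (simp add: d_def det_2)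
  have "d = of_int (det A)" by (simp add: d_def det_2 M_def)
  with invertible_int_det[of A] assms(1) have d: "\<bar>d\<bar> = 1"
    by (simp add: hyperbolic_matrix_def flip: of_int_abs)
  have no: "cmod c \<noteq> 1" if "c * c - of_real t * c + of_real d = 0" for c
  proof -
    have "eigenvalue_of A c" unfolding eigenvalue_of_def
      by (rule eigenvector_2x2) (use that in \<open>simp add: t_def d_def M_def\<close>)
    then show ?thesis using assms(1) by (simp add: hyperbolic_matrix_def)
  qed
  have D: "t\<^sup>2 - 4 * d \<ge> 0"
  proof (rule ccontr)
    assume "\<not> ?thesis"
    then have neg: "t\<^sup>2 - 4 * d < 0" by simp
    have d1: "d = 1" using d neg zero_le_power2[of t] by linarith
    define s where "s = sqrt (4 * d - t\<^sup>2)"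
    have s2: "s * s = 4 * d - t\<^sup>2" using neg by (simp add: s_def)
    define c where "c = Complex (t/2) (s/2)"
    have "c * c - of_real t * c + of_real d = 0"
      using s2 by (simp add: c_def complex_eq_iff power2_eq_square) (simp add: field_simps)
    moreover have "cmod c = 1"
      using s2 d1 by (simp add: c_def cmod_def power2_eq_square field_simps)
    ultimately show False using no by blast
  qed
  define s where "s = sqrt (t\<^sup>2 - 4 * d)"
  have s2: "s * s = t\<^sup>2 - 4 * d" using D by (simp add: s_def)
  define r1 where "r1 = (t + s) / 2"
  define r2 where "r2 = (t - s) / 2"
  have r1: "r1 * r1 - t * r1 + d = 0" and r2: "r2 * r2 - t * r2 + d = 0"
    using s2 by (simp_all add: r1_def r2_def power2_eq_square field_simps)
  have prod: "r1 * r2 = d"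
    using s2 by (simp add: r1_def r2_def power2_eq_square field_simps)
  have "\<bar>r\<bar> \<noteq> 1" if "r * r - t * r + d = 0" for r
  proof -
    have "complex_of_real (r * r - t * r + d) = 0" using that by simp
    then show ?thesis using no[of "of_real r"] by simp
  qed
  then have ne: "\<bar>r1\<bar> \<noteq> 1" "\<bar>r2\<bar> \<noteq> 1" using r1 r2 by blast+
  have ab: "\<bar>r1\<bar> * \<bar>r2\<bar> = 1" using prod d by (simp flip: abs_mult)
  have "\<bar>r1\<bar> < 1 \<or> \<bar>r2\<bar> < 1"
  proof (rule ccontr)
    assume "\<not> ?thesis"
    then have "1 < \<bar>r1\<bar>" "1 < \<bar>r2\<bar>" using ne by auto
    then have "1 < \<bar>r1\<bar> * \<bar>r2\<bar>" by (rule less_1_mult)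
    then show False using ab by simp
  qed
  moreover have "r1 \<noteq> 0" "r2 \<noteq> 0" using ab by auto
  ultimately obtain l where l: "\<bar>l\<bar> < 1" "l \<noteq> 0" "l * l - t * l + d = 0"
    using r1 r2 by blast
  then obtain u where "u \<noteq> 0" "M *v u = l *s u"
    using eigenvector_2x2[of l M] by (auto simp: t_def d_def)
  then show ?thesis using that l d dM by blast
qed

lemma hyperbolic_matrix_functional:
  assumes "hyperbolic_matrix A"
  obtains p :: "real^2 \<Rightarrow> real" and m :: real and u
  where "linear p" "u \<noteq> 0" "contracting_eigenline A = span {u}" "\<bar>m\<bar> > 1"
    "\<And>x. p (real_matrix A *v x) = m * p x" "\<And>x. p x = 0 \<longleftrightarrow> x \<in> contracting_eigenline A"
proof -
  define M where "M = real_matrix A"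
  obtain l u where u: "u \<noteq> 0" "M *v u = l *s u" and l: "\<bar>l\<bar> < 1" "\<bar>det M\<bar> = 1" "l \<noteq> 0"
    using hyperbolic_matrix_contracting_eigenvalue[OF assms] unfolding M_def by blast
  define p where "p = (\<lambda>x::real^2. u$1 * x$2 - u$2 * x$1)"
  define m where "m = det M / l"
  have lin: "linear p" by (rule linearI) (simp_all add: p_def algebra_simps)
  have m: "\<bar>m\<bar> > 1" using l by (simp add: m_def abs_divide)
  have e: "M$1$1 * u$1 + M$1$2 * u$2 = l * u$1" "M$2$1 * u$1 + M$2$2 * u$2 = l * u$2"
    using u(2) by (simp_all add: vec_eq_iff forall_2 matrix_vector_mult_def sum_2)
  have pM: "p (M *v x) = m * p x" for x
  proof -
    have "l * p (M *v x) = det M * p x"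
      unfolding p_def det_2
      apply (simp add: matrix_vector_mult_def sum_2)
      using e by algebra
    then show ?thesis using l by (simp add: m_def field_simps)
  qed
  have p0: "p x = 0 \<longleftrightarrow> x \<in> span {u}" for x
  proof
    assume h: "p x = 0"
    consider "u$1 \<noteq> 0" | "u$2 \<noteq> 0" using u(1) by (auto simp: vec_eq_iff forall_2)
    then have "\<exists>k. x = k *\<^sub>R u"
    proof cases
      case 1
      then have "x = (x$1 / u$1) *\<^sub>R u" using h
        by (simp add: vec_eq_iff forall_2 p_def field_simps)
      then show ?thesis by blast
    next
      case 2
      then have "x = (x$2 / u$2) *\<^sub>R u" using h
        by (simp add: vec_eq_iff forall_2 p_def field_simps)
      then show ?thesis by blast
    qed
    then show "x \<in> span {u}" by (auto simp: span_singleton)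
  next
    assume "x \<in> span {u}"
    then show "p x = 0" by (auto simp: span_singleton p_def)
  qed
  have L: "contracting_eigenline A = span {u}"
  proof
    show "contracting_eigenline A \<subseteq> span {u}"
    proof
      fix v assume "v \<in> contracting_eigenline A"
      then obtain c where c: "\<bar>c\<bar> < 1" "M *v v = c *\<^sub>R v"
        by (auto simp: contracting_eigenline_def M_def)
      then have "m * p v = c * p v" using pM[of v] linear_scale[OF lin, of c v] by auto
      then have "p v = 0 \<or> m = c" by (metis mult_right_cancel)
      then have "p v = 0" using c m by auto
      then show "v \<in> span {u}" using p0 by blast
    qed
    show "span {u} \<subseteq> contracting_eigenline A"
    proof
      fix v assume "v \<in> span {u}"
      then obtain k where "v = k *\<^sub>R u" by (auto simp: span_singleton)
      then have "M *v v = l *\<^sub>R v"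
        using u(2) by (simp add: matrix_vector_mult_scaleR scalar_mult_eq_scaleR)
      then show "v \<in> contracting_eigenline A"
        using l by (auto simp: contracting_eigenline_def M_def)
    qed
  qed
  show ?thesis
    by (rule that[OF lin u(1) L m]) (use pM p0 L in \<open>auto simp: M_def\<close>)
qed

lemma torus_proj_eq_iff: "torus_proj x = torus_proj y \<longleftrightarrow> (\<forall>i. x $ i - y $ i \<in> \<int>)"
  by (simp add: torus.abs_eq_iff torus_rel_def)

lemma continuous_torus_proj: "continuous_on UNIV torus_proj"
  by (simp add: continuous_on_open_vimage open_torus_def)

lemma open_torus_proj_image:
  assumes "open U"
  shows "open (torus_proj ` U)"
proof -
  have "torus_proj -` torus_proj ` U = (\<Union>z\<in>{z. \<forall>i. z $ i \<in> \<int>}. (+) z ` U)"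
  proof (intro equalityI subsetI)
    fix x assume "x \<in> torus_proj -` torus_proj ` U"
    then obtain y where y: "y \<in> U" "torus_proj x = torus_proj y" by auto
    then have "x - y \<in> {z. \<forall>i. z $ i \<in> \<int>}" by (simp add: torus_proj_eq_iff)
    moreover have "x \<in> (+) (x - y) ` U" using y(1) by force
    ultimately show "x \<in> (\<Union>z\<in>{z. \<forall>i. z $ i \<in> \<int>}. (+) z ` U)" by blast
  next
    fix x assume "x \<in> (\<Union>z\<in>{z. \<forall>i. z $ i \<in> \<int>}. (+) z ` U)"
    then obtain z y where "\<forall>i. z $ i \<in> \<int>" "y \<in> U" "x = z + y" by auto
    then have "torus_proj x = torus_proj y" by (simp add: torus_proj_eq_iff)
    then show "x \<in> torus_proj -` torus_proj ` U" using \<open>y \<in> U\<close> by auto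
  qed
  then show ?thesis using assms by (auto simp: open_torus_def intro!: open_translation)
qed

lemma toral_map_funpow:
  "(toral_map A ^^ n) (torus_proj x) = torus_proj (((*v) (real_matrix A) ^^ n) x)"
  by (induction n) (simp_all add: toral_map.abs_eq)

lemma integer_vector_small:
  fixes z :: "real^2"
  assumes "\<forall>i. z $ i \<in> \<int>" "norm z < 1"
  shows "z = 0"
proof -
  have "z $ i = 0" for i
    using assms component_le_norm_cart[of z i] Ints_nonzero_abs_less1[of "z $ i"] by fastforce
  then show ?thesis by (simp add: vec_eq_iff)
qed

lemma stable_manifold_functional:
  fixes p :: "real^2 \<Rightarrow> real"
  assumes lin: "linear p" and m: "\<bar>m\<bar> > 1"
    and p: "\<And>x. p (real_matrix A *v x) = m * p x"
    and x: "torus_proj x \<in> stable_manifold (toral_map A)"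
  shows "\<exists>N z. (\<forall>i. z $ i \<in> \<int>) \<and> p x = p z / m ^ N"
proof -
  define M where "M = real_matrix A"
  define F where "F n = ((*v) M ^^ n)" for n
  have FSuc: "F (Suc n) y = M *v F n y" for n y by (simp add: F_def)
  have pF: "p (F n y) = m ^ n * p y" for n y
  proof (induction n)
    case 0
    show ?case by (simp add: F_def)
  next
    case (Suc n)
    then show ?case using p[of "F n y"] by (simp add: FSuc M_def)
  qed
  obtain K where K: "K > 0" "\<And>y. norm (M *v y) \<le> norm y * K"
    using bounded_linear.pos_bounded[OF matrix_vector_mul_bounded_linear[of M]] by blast
  obtain Q where Q: "Q > 0" "\<And>y. norm (p y) \<le> norm y * Q"
    using bounded_linear.pos_bounded[of p] lin linear_conv_bounded_linear by blast
  define e where "e = 1 / (K + 2)"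
  have e: "e > 0" "e * K + e < 1" using K by (simp_all add: e_def field_simps)
  have "open (torus_proj ` ball 0 e)" "torus_proj 0 \<in> torus_proj ` ball 0 e"
    using e by (auto intro: open_torus_proj_image)
  then have "\<forall>\<^sub>F n in sequentially. (toral_map A ^^ n) (torus_proj x) \<in> torus_proj ` ball 0 e"
    using x unfolding stable_manifold_def by (blast dest: topological_tendstoD)
  then obtain N where "\<forall>n\<ge>N. torus_proj (F n x) \<in> torus_proj ` ball 0 e"
    by (auto simp: eventually_sequentially toral_map_funpow F_def M_def)
  then have "\<forall>n. \<exists>z. n \<ge> N \<longrightarrow> norm z < e \<and> torus_proj (F n x) = torus_proj z"
    by (metis imageE mem_ball_0)
  then obtain z where z: "\<And>n. n \<ge> N \<Longrightarrow> norm (z n) < e"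
    "\<And>n. n \<ge> N \<Longrightarrow> torus_proj (F n x) = torus_proj (z n)" by metis
  have step: "z (Suc n) = M *v z n" if n: "n \<ge> N" for n
  proof -
    have "torus_proj (M *v z n) = toral_map A (torus_proj (F n x))"
      using z(2)[OF n] by (simp add: toral_map.abs_eq M_def)
    also have "\<dots> = torus_proj (z (Suc n))"
      using z(2)[of "Suc n"] n by (simp add: toral_map.abs_eq FSuc M_def)
    finally have "\<forall>i. (M *v z n - z (Suc n)) $ i \<in> \<int>" by (simp add: torus_proj_eq_iff)
    moreover have "norm (M *v z n - z (Suc n)) < 1"
    proof -
      have "norm (M *v z n - z (Suc n)) \<le> norm (M *v z n) + norm (z (Suc n))"
        by (rule norm_triangle_ineq4)
      also have "\<dots> \<le> e * K + e"
        using K(2)[of "z n"] z(1)[OF n] z(1)[of "Suc n"] n K(1)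
          mult_right_mono[of "norm (z n)" e K] by linarith
      finally show ?thesis using e by simp
    qed
    ultimately have "M *v z n - z (Suc n) = 0" by (rule integer_vector_small)
    then show ?thesis by simp
  qed
  have zk: "p (z (N + k)) = m ^ k * p (z N)" for k
    by (induction k) (use p step in \<open>simp_all add: M_def\<close>)
  have "p (z N) = 0"
  proof (rule ccontr)
    assume "p (z N) \<noteq> 0"
    obtain k where "e * Q / \<bar>p (z N)\<bar> < \<bar>m\<bar> ^ k" using m real_arch_pow by blast
    then have "e * Q < \<bar>p (z (N + k))\<bar>"
      using \<open>p (z N) \<noteq> 0\<close> by (simp add: zk abs_mult power_abs field_simps)
    moreover have "\<bar>p (z (N + k))\<bar> \<le> e * Q"
      using Q(2)[of "z (N + k)"] z(1)[of "N + k"] Q(1)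
        mult_right_mono[of "norm (z (N + k))" e Q] by (simp add: order_trans)
    ultimately show False by simp
  qed
  then have "p (F N x - z N) = m ^ N * p x" using pF lin by (simp add: linear_diff)
  then have "p x = p (F N x - z N) / m ^ N" using m by (auto simp: field_simps)
  moreover have "\<forall>i. (F N x - z N) $ i \<in> \<int>" using z(2)[of N] by (simp add: torus_proj_eq_iff)
  ultimately show ?thesis by blast
qed

lemma countable_integer_vectors: "countable {z :: real^2. \<forall>i. z $ i \<in> \<int>}"
proof -
  have "z \<in> (\<lambda>(a, b). vector [of_int a, of_int b] :: real^2) ` UNIV" if "\<forall>i. z $ i \<in> \<int>" for z
  proof -
    have "z $ 1 \<in> \<int>" "z $ 2 \<in> \<int>" using that by auto
    then obtain a b where "z $ 1 = of_int a" "z $ 2 = of_int b" by (auto elim!: Ints_cases)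
    then have "z = vector [of_int a, of_int b]" by (simp add: vec_eq_iff forall_2)
    then show ?thesis by auto
  qed
  then show ?thesis by (blast intro: countable_subset countable_image countableI_type)
qed

lemma torus_lie_algebra_stable_manifold:
  assumes "hyperbolic_matrix A"
  shows "torus_lie_algebra (stable_manifold (toral_map A)) = contracting_eigenline A"
proof -
  obtain p :: "real^2 \<Rightarrow> real" and m :: real and u where
    lin: "linear p" and u: "contracting_eigenline A = span {u}" and m: "\<bar>m\<bar> > 1"
    and p: "\<And>x. p (real_matrix A *v x) = m * p x"
    and p0: "\<And>x. p x = 0 \<longleftrightarrow> x \<in> contracting_eigenline A"
    by (rule hyperbolic_matrix_functional[OF assms]) blast
  show ?thesis
  proof
    show "torus_lie_algebra (stable_manifold (toral_map A)) \<subseteq> contracting_eigenline A"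
    proof
      fix v assume v: "v \<in> torus_lie_algebra (stable_manifold (toral_map A))"
      let ?Z = "{z :: real^2. \<forall>i. z $ i \<in> \<int>}"
      define C where "C = (\<lambda>(N::nat, z). p z / m ^ N) ` (UNIV \<times> ?Z)"
      have "countable C"
        unfolding C_def by (intro countable_image countable_SIGMA countable_integer_vectors) auto
      have C: "t * p v \<in> C" for t
      proof -
        have "torus_proj (t *\<^sub>R v) \<in> stable_manifold (toral_map A)"
          using v by (simp add: torus_lie_algebra_def)
        then obtain N z where "\<forall>i. z $ i \<in> \<int>" "p (t *\<^sub>R v) = p z / m ^ N"
          using stable_manifold_functional[OF lin m p] by blast
        then have "t * p v = (\<lambda>(N, z). p z / m ^ N) (N, z)" using lin by (simp add: linear_scale)
        then show ?thesis unfolding C_def using \<open>\<forall>i. z $ i \<in> \<int>\<close> by blast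
      qed
      have "p v = 0"
      proof (rule ccontr)
        assume "p v \<noteq> 0"
        then have "r \<in> C" for r using C[of "r / p v"] by simp
        then have "C = UNIV" by blast
        then show False using \<open>countable C\<close> uncountable_UNIV_real by simp
      qed
      then show "v \<in> contracting_eigenline A" using p0 by blast
    qed
    show "contracting_eigenline A \<subseteq> torus_lie_algebra (stable_manifold (toral_map A))"
    proof
      fix v assume "v \<in> contracting_eigenline A"
      then obtain c where c: "\<bar>c\<bar> < 1" "real_matrix A *v v = c *\<^sub>R v"
        by (auto simp: contracting_eigenline_def)
      have it: "((*v) (real_matrix A) ^^ n) (t *\<^sub>R v) = (c ^ n * t) *\<^sub>R v" for n t
        by (induction n) (simp_all add: matrix_vector_mult_scaleR c(2) mult_ac)
      have "(\<lambda>n. (toral_map A ^^ n) (torus_proj (t *\<^sub>R v))) \<longlonglongrightarrow> torus_proj 0" for t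
      proof -
        have "(\<lambda>n. (c ^ n * t) *\<^sub>R v) \<longlonglongrightarrow> (0 * t) *\<^sub>R v"
          using c(1) by (intro tendsto_intros LIMSEQ_power_zero) simp
        then have "(\<lambda>n. torus_proj ((c ^ n * t) *\<^sub>R v)) \<longlonglongrightarrow> torus_proj ((0 * t) *\<^sub>R v)"
          by (rule continuous_on_tendsto_compose[OF continuous_torus_proj]) auto
        then show ?thesis by (simp add: toral_map_funpow it)
      qed
      then show "v \<in> torus_lie_algebra (stable_manifold (toral_map A))"
        by (simp add: torus_lie_algebra_def stable_manifold_def)
    qed
  qed
qed

lemma torus_dim_stable_manifolds_iff:
  assumes "hyperbolic_matrix A" "hyperbolic_matrix B"
  shows "torus_dim (stable_manifold (toral_map A) \<inter> stable_manifold (toral_map B)) = 0 \<longleftrightarrow>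
    contracting_eigenline A \<noteq> contracting_eigenline B"
proof -
  obtain u where u: "u \<noteq> 0" "contracting_eigenline A = span {u}"
    using hyperbolic_matrix_functional[OF assms(1)] by metis
  obtain w where w: "w \<noteq> 0" "contracting_eigenline B = span {w}"
    using hyperbolic_matrix_functional[OF assms(2)] by metis
  have "torus_lie_algebra (stable_manifold (toral_map A) \<inter> stable_manifold (toral_map B))
      = span {u} \<inter> span {w}"
    using torus_lie_algebra_stable_manifold[OF assms(1)] torus_lie_algebra_stable_manifold[OF assms(2)]
      u w by (auto simp: torus_lie_algebra_def)
  then have "torus_dim (stable_manifold (toral_map A) \<inter> stable_manifold (toral_map B)) = 0 \<longleftrightarrow>
      span {u} \<inter> span {w} \<subseteq> {0}"
    by (simp add: torus_dim_def)
  also have "\<dots> \<longleftrightarrow> span {u} \<noteq> span {w}"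
  proof
    assume "span {u} \<inter> span {w} \<subseteq> {0}"
    then show "span {u} \<noteq> span {w}" using u(1) span_base[of u "{u}"] by auto
  next
    assume ne: "span {u} \<noteq> span {w}"
    show "span {u} \<inter> span {w} \<subseteq> {0}"
    proof
      fix x assume "x \<in> span {u} \<inter> span {w}"
      then obtain a b where ab: "x = a *\<^sub>R u" "x = b *\<^sub>R w"
        by (metis IntD1 IntD2 rangeE span_singleton)
      have "x = 0"
      proof (rule ccontr)
        assume "x \<noteq> 0"
        then have "a \<noteq> 0" "b \<noteq> 0" using ab by auto
        then have "u = (b / a) *\<^sub>R w" "w = (a / b) *\<^sub>R u"
          using ab by (simp_all add: vector_fraction_eq_iff eq_vector_fraction_iff)
        then have "u \<in> span {w}" "w \<in> span {u}"
          by (metis span_base span_scale singletonI)+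
        then have "span {u} = span {w}"
          by (simp add: span_minimal subset_antisym)
        then show False using ne by blast
      qed
      then show "x \<in> {0}" by simp
    qed
  qed
  finally show ?thesis using u w by simp
qed

end

theory Submission
  imports Defs
begin

text \<open>The contracting eigenline \<open>L\<close> of \<open>T\<close> consists of points whose \<open>T\<close>-orbit converges to the
  origin, so it projects into \<open>ND(T)\<close>. If the contracting eigenline of \<open>S\<close> differs from \<open>L\<close>,
  then \<open>S\<^sup>n\<close> stretches every segment of \<open>L\<close> into a long, almost straight segment in the expanding
  direction of \<open>S\<close>. That direction has irrational slope, hence long segments enter any given open
  set, and the parameters in \<open>L\<close> with dense \<open>S\<close>-orbit form a residual set. As there are only
  countably many \<open>S\<close>, Baire's theorem on \<open>L\<close> yields a dense uncountable set of parameters; it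
  remains dense in the torus because \<open>L\<close> has irrational slope, too.\<close>

section \<open>Integer vectors and eigenvectors\<close>

lemma real_matrix_mult: "real_matrix (A ** B) = real_matrix A ** real_matrix B"
  by (simp add: vec_eq_iff matrix_matrix_mult_def)

lemma real_matrix_mult_integer_vector:
  assumes "\<forall>i. z $ i \<in> \<int>"
  shows "\<forall>i. (real_matrix A *v z) $ i \<in> \<int>"
  using assms by (auto simp: matrix_vector_mult_def intro!: Ints_sum Ints_mult)

text \<open>The vectors \<open>c ^ n *\<^sub>R z\<close> are iterates of an integer vector, hence
  integral, and they tend to 0, so one of them vanishes. The case \<open>c = 0\<close> is still
  possible here, which is why the conclusion keeps the factor \<open>c\<close>.\<close>

lemma integer_vector_contracted:
  fixes z :: "real^2"
  assumes z: "\<forall>i. z $ i \<in> \<int>" and ev: "real_matrix A *v z = c *\<^sub>R z" and c: "\<bar>c\<bar> < 1"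
  shows "c *\<^sub>R z = 0"
proof -
  have int: "\<forall>i. (c ^ n *\<^sub>R z) $ i \<in> \<int>" for n
  proof (induction n)
    case 0
    show ?case using z by simp
  next
    case (Suc n)
    have "c ^ Suc n *\<^sub>R z = real_matrix A *v (c ^ n *\<^sub>R z)"
      by (simp add: matrix_vector_mult_scaleR ev mult.commute)
    then show ?case using real_matrix_mult_integer_vector[OF Suc] by simp
  qed
  have "(\<lambda>n. c ^ n *\<^sub>R z) \<longlonglongrightarrow> 0 *\<^sub>R z"
    using c by (intro tendsto_intros LIMSEQ_power_zero) simp
  then have "(\<lambda>n. norm (c ^ n *\<^sub>R z)) \<longlonglongrightarrow> 0"
    by (intro tendsto_norm_zero) simp
  then have "\<forall>\<^sub>F n in sequentially. norm (c ^ n *\<^sub>R z) < 1" by (rule order_tendstoD) simp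
  then obtain n where "norm (c ^ n *\<^sub>R z) < 1" by (auto simp: eventually_sequentially)
  then have "c ^ n *\<^sub>R z = 0" using int integer_vector_small by blast
  then show ?thesis by auto
qed

text \<open>Either the matrix or its integral inverse contracts \<open>z\<close>: for the inverse,
  \<open>z\<close> is an eigenvector with eigenvalue \<open>inverse c\<close>. This is the source of
  the irrationality of both eigenlines.\<close>

lemma integer_eigenvector_eq_0:
  fixes z :: "real^2"
  assumes A: "invertible A" and z: "\<forall>i. z $ i \<in> \<int>"
    and ev: "real_matrix A *v z = c *\<^sub>R z" and c: "\<bar>c\<bar> \<noteq> 1"
  shows "z = 0"
proof -
  obtain B where B: "B ** A = mat 1" using A unfolding invertible_def by blast
  have "real_matrix B ** real_matrix A = mat 1"
    by (subst real_matrix_mult[symmetric]) (simp add: B vec_eq_iff mat_def)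
  then have "z = real_matrix B *v (real_matrix A *v z)"
    by (simp add: matrix_vector_mul_assoc)
  then have inv: "z = c *\<^sub>R (real_matrix B *v z)"
    by (simp add: ev matrix_vector_mult_scaleR)
  show ?thesis
  proof (cases "\<bar>c\<bar> < 1")
    case True
    \<comment> \<open>If it is \<open>c\<close> that vanishes, \<open>inv\<close> still forces
      \<open>z = 0\<close>.\<close>
    then have "c *\<^sub>R z = 0" using integer_vector_contracted[OF z ev] by blast
    then show ?thesis using inv by auto
  next
    case False
    then have c1: "\<bar>c\<bar> > 1" using c by simp
    then have "inverse c *\<^sub>R z = inverse c *\<^sub>R (c *\<^sub>R (real_matrix B *v z))"
      using inv by argo
    also have "\<dots> = real_matrix B *v z" using c1 by auto
    finally have "real_matrix B *v z = inverse c *\<^sub>R z" by simp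
    moreover have "\<bar>inverse c\<bar> < 1" using c1 by (simp add: inverse_less_1_iff)
    ultimately have "inverse c *\<^sub>R z = 0" using integer_vector_contracted[OF z] by blast
    then show ?thesis using c1 by auto
  qed
qed

section \<open>Lines of irrational slope\<close>

text \<open>Dirichlet approximation provides a multiple \<open>k\<close> of \<alpha> at distance
  less than \<delta> from an integer; the difference \<theta> is nonzero by irrationality. Walking
  around the circle in steps of \<theta> comes close to every point. What matters later is that
  \<open>K\<close> serves all \<beta> at once.\<close>

lemma irrational_rotation_uniformly_dense:
  fixes \<alpha> :: real
  assumes irr: "\<alpha> \<notin> \<rat>" and \<delta>: "\<delta> > 0"
  obtains K :: int
  where "\<And>\<beta>. \<exists>j h :: int. 0 \<le> j \<and> j \<le> K \<and> \<bar>of_int j * \<alpha> - \<beta> - of_int h\<bar> < \<delta>"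
proof -
  obtain N :: nat where N: "N > 0" "1 / N < \<delta>"
    using \<delta> reals_Archimedean by (metis inverse_eq_divide zero_less_Suc)
  obtain h k where k: "0 < k" "\<bar>of_int k * \<alpha> - of_int h\<bar> < 1 / N"
    using Dirichlet_approx[OF N(1)] by metis
  define \<theta> where "\<theta> = of_int k * \<alpha> - of_int h"
  have \<theta>: "\<theta> \<noteq> 0"
  proof
    assume "\<theta> = 0"
    then have "\<alpha> = of_int h / of_int k" using k by (simp add: \<theta>_def field_simps)
    then show False using irr by auto
  qed
  have less: "\<bar>\<theta>\<bar> < \<delta>" using k N by (simp add: \<theta>_def)
  show ?thesis
  \<comment> \<open>About \<open>1 / \<bar>\<theta>\<bar>\<close> steps go once around the circle,
    and each step costs \<open>k\<close> rotations by \<alpha>.\<close>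
  proof (rule that[of "k * \<lfloor>1 / \<bar>\<theta>\<bar>\<rfloor>"])
    fix \<beta> :: real
    \<comment> \<open>\<open>f\<close> is the position of \<beta> on the circle, measured in the
      direction in which \<theta> moves; \<open>i\<close> counts the whole steps that fit below it,
      so step \<open>i\<close> misses \<open>f\<close> by less than
      \<open>\<bar>\<theta>\<bar>\<close>.\<close>
    define f where "f = frac (sgn \<theta> * \<beta>)"
    define i where "i = \<lfloor>f / \<bar>\<theta>\<bar>\<rfloor>"
    have f: "0 \<le> f" "f < 1" by (simp_all add: f_def frac_lt_1)
    have i0: "0 \<le> i" using f by (simp add: i_def)
    have iK: "i \<le> \<lfloor>1 / \<bar>\<theta>\<bar>\<rfloor>"
      unfolding i_def using f by (intro floor_mono divide_right_mono) auto
    have "of_int i \<le> f / \<bar>\<theta>\<bar>" "f / \<bar>\<theta>\<bar> < of_int i + 1"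
      unfolding i_def by linarith+
    then have "of_int i * \<bar>\<theta>\<bar> \<le> f" "f < of_int i * \<bar>\<theta>\<bar> + \<bar>\<theta>\<bar>"
      using \<theta> by (simp_all add: field_simps)
    then have near: "\<bar>of_int i * \<bar>\<theta>\<bar> - f\<bar> < \<delta>" using less by linarith
    have "\<exists>g::int. \<bar>of_int i * \<theta> - \<beta> - of_int g\<bar> < \<delta>"
    proof (cases "\<theta> > 0")
      case True
      then have "\<bar>of_int i * \<theta> - \<beta> - of_int (- \<lfloor>\<beta>\<rfloor>)\<bar> < \<delta>"
        using near by (simp add: f_def frac_def algebra_simps)
      then show ?thesis by blast
    next
      case False
      then have "\<bar>of_int i * \<theta> - \<beta> - of_int \<lfloor>- \<beta>\<rfloor>\<bar> < \<delta>"
        using near \<theta> by (simp add: f_def frac_def)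
      then show ?thesis by blast
    qed
    then obtain g where g: "\<bar>of_int i * \<theta> - \<beta> - of_int g\<bar> < \<delta>" by blast
    have "of_int i * \<theta> - \<beta> - of_int g = of_int (k * i) * \<alpha> - \<beta> - of_int (g + i * h)"
      by (simp add: \<theta>_def algebra_simps)
    with g have "\<bar>of_int (k * i) * \<alpha> - \<beta> - of_int (g + i * h)\<bar> < \<delta>" by metis
    moreover have "0 \<le> k * i" "k * i \<le> k * \<lfloor>1 / \<bar>\<theta>\<bar>\<rfloor>"
      using k i0 iK by (simp_all add: mult_left_mono)
    ultimately show "\<exists>j h :: int. 0 \<le> j \<and> j \<le> k * \<lfloor>1 / \<bar>\<theta>\<bar>\<rfloor> \<and>
        \<bar>of_int j * \<alpha> - \<beta> - of_int h\<bar> < \<delta>"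
      by blast
  qed
qed

text \<open>Irrationality of the slope, expressed without coordinates as the line meeting the
  integer lattice only at the origin. Eigenvectors satisfy this form directly.\<close>

definition irrational_direction :: "real^2 \<Rightarrow> bool" where
  "irrational_direction w \<longleftrightarrow> w \<noteq> 0 \<and> (\<forall>s. (\<forall>i. (s *\<^sub>R w) $ i \<in> \<int>) \<longrightarrow> s *\<^sub>R w = 0)"

lemma irrational_direction_eigenvector:
  assumes "invertible A" "real_matrix A *v w = c *\<^sub>R w" "\<bar>c\<bar> \<noteq> 1" "w \<noteq> 0"
  shows "irrational_direction w"
proof -
  have "real_matrix A *v (s *\<^sub>R w) = c *\<^sub>R (s *\<^sub>R w)" for s
    using assms(2) by (simp add: matrix_vector_mult_scaleR mult.commute)
  then show ?thesis
    using integer_eigenvector_eq_0[OF assms(1)] assms(3,4) unfolding irrational_direction_def by blast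
qed

text \<open>A vertical line, or one of slope \<open>a / b\<close>, contains the nonzero lattice
  point (0, 1) or (b, a), respectively.\<close>

lemma irrational_direction_slope:
  assumes w: "irrational_direction w"
  shows "w $ 1 \<noteq> 0" "w $ 2 / w $ 1 \<notin> \<rat>"
proof -
  have int: "s = 0" if "(s *\<^sub>R w) $ 1 \<in> \<int>" "(s *\<^sub>R w) $ 2 \<in> \<int>" for s
    using w that unfolding irrational_direction_def by (auto simp: forall_2)
  show w1: "w $ 1 \<noteq> 0"
  proof
    assume h: "w $ 1 = 0"
    then have "w $ 2 \<noteq> 0" using w by (auto simp: irrational_direction_def vec_eq_iff forall_2)
    then show False using int[of "1 / w $ 2"] h by simp
  qed
  show "w $ 2 / w $ 1 \<notin> \<rat>"
  proof
    assume "w $ 2 / w $ 1 \<in> \<rat>"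
    then obtain a b :: int where "b > 0" "w $ 2 / w $ 1 = of_int a / of_int b"
      by (meson Rats_cases')
    then have "(of_int b / w $ 1) * w $ 2 = of_int a" using w1 by (simp add: field_simps)
    then have "of_int b / w $ 1 = 0" using w1 by (intro int) simp_all
    then show False using w1 \<open>b > 0\<close> by simp
  qed
qed

text \<open>The line crosses the verticals whose first coordinate is congruent to
  \<open>q $ 1\<close>, and from one crossing to the next the height is rotated by the slope
  \<alpha>. The uniform bound \<open>K\<close> therefore yields a length \<open>R\<close> that
  depends neither on the target \<open>q\<close> nor on the position \<open>s0\<close>.\<close>

lemma irrational_line_relatively_dense:
  assumes w: "irrational_direction w" and \<delta>: "\<delta> > 0"
  obtains R where "\<And>q s0. \<exists>s z. \<bar>s - s0\<bar> \<le> R \<and> (\<forall>i. z $ i \<in> \<int>) \<and> norm (s *\<^sub>R w - q - z) < \<delta>"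
proof -
  define \<alpha> where "\<alpha> = w $ 2 / w $ 1"
  have w1: "w $ 1 \<noteq> 0" and irr: "\<alpha> \<notin> \<rat>"
    using irrational_direction_slope[OF w] by (simp_all add: \<alpha>_def)
  obtain K :: int where K:
    "\<And>\<beta>. \<exists>j h :: int. 0 \<le> j \<and> j \<le> K \<and> \<bar>of_int j * \<alpha> - \<beta> - of_int h\<bar> < \<delta>"
    by (rule irrational_rotation_uniformly_dense[OF irr \<delta>]) blast
  show ?thesis
  proof (rule that[of "(of_int K + 1) / \<bar>w $ 1\<bar>"])
    fix q :: "real^2" and s0 :: real
    \<comment> \<open>\<open>k0\<close> indexes a crossing next to \<open>s0\<close>. Rounding costs
      at most 1 in the first coordinate, hence the summand 1 in the bound.\<close>
    define k0 where "k0 = \<lfloor>s0 * w $ 1 - q $ 1\<rfloor>"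
    obtain j h :: int where j: "0 \<le> j" "j \<le> K"
      "\<bar>of_int j * \<alpha> - (q $ 2 - (q $ 1 + of_int k0) * \<alpha>) - of_int h\<bar> < \<delta>"
      using K by blast
    define s where "s = (q $ 1 + of_int (k0 + j)) / w $ 1"
    define z :: "real^2" where "z = vector [of_int (k0 + j), of_int h]"
    have "s * w $ 1 = q $ 1 + of_int (k0 + j)" using w1 by (simp add: s_def)
    moreover have "s * w $ 2 = (q $ 1 + of_int (k0 + j)) * \<alpha>" by (simp add: s_def \<alpha>_def)
    ultimately have comp: "(s *\<^sub>R w - q - z) $ 1 = 0"
      "(s *\<^sub>R w - q - z) $ 2 = of_int j * \<alpha> - (q $ 2 - (q $ 1 + of_int k0) * \<alpha>) - of_int h"
      by (simp_all add: z_def algebra_simps)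
    have "norm (s *\<^sub>R w - q - z) \<le> (\<Sum>i\<in>UNIV. \<bar>(s *\<^sub>R w - q - z) $ i\<bar>)"
      by (rule norm_le_l1_cart)
    also have "\<dots> < \<delta>" unfolding sum_2 comp using j by simp
    finally have n: "norm (s *\<^sub>R w - q - z) < \<delta>" .
    have "\<bar>s - s0\<bar> * \<bar>w $ 1\<bar> = \<bar>q $ 1 + of_int (k0 + j) - s0 * w $ 1\<bar>"
      using w1 by (simp add: s_def left_diff_distrib flip: abs_mult)
    also have "\<dots> \<le> of_int K + 1"
      using j(1,2) unfolding k0_def by linarith
    finally have "\<bar>s - s0\<bar> \<le> (of_int K + 1) / \<bar>w $ 1\<bar>"
      using w1 by (simp add: pos_le_divide_eq)
    moreover have "\<forall>i. z $ i \<in> \<int>" by (simp add: z_def forall_2)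
    ultimately show "\<exists>s z. \<bar>s - s0\<bar> \<le> (of_int K + 1) / \<bar>w $ 1\<bar> \<and> (\<forall>i. z $ i \<in> \<int>) \<and>
        norm (s *\<^sub>R w - q - z) < \<delta>"
      using n by blast
  qed
qed

text \<open>Used at the end to pass from density of parameters on the line to density in the
  torus.\<close>

lemma irrational_line_meets_open:
  assumes w: "irrational_direction w" and U: "open U" "U \<noteq> {}"
  shows "\<exists>s. torus_proj (s *\<^sub>R w) \<in> U"
proof -
  obtain q where "torus_proj q \<in> U" using U(2) torus.abs_induct[of "\<lambda>y. y \<notin> U"] by auto
  moreover have "open (torus_proj -` U)" using U(1) by (simp add: open_torus_def)
  ultimately obtain \<delta> where \<delta>: "\<delta> > 0" "ball q \<delta> \<subseteq> torus_proj -` U"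
    by (metis openE vimageI)
  obtain s z where s: "\<forall>i. z $ i \<in> \<int>" "norm (s *\<^sub>R w - q - z) < \<delta>"
    using irrational_line_relatively_dense[OF w \<delta>(1)] by metis
  have "torus_proj (s *\<^sub>R w) = torus_proj (s *\<^sub>R w - z)"
    using s(1) by (simp add: torus_proj_eq_iff)
  moreover have "s *\<^sub>R w - z \<in> ball q \<delta>"
    using s(2) by (simp add: dist_norm norm_minus_commute algebra_simps)
  ultimately have "torus_proj (s *\<^sub>R w) \<in> U" using \<delta>(2) by auto
  then show ?thesis by blast
qed

section \<open>Stretching of segments transverse to the contracting eigenline\<close>

text \<open>Since \<open>p\<close> is multiplied by \<open>m\<close>, the vector
  \<open>M *v v - m *\<^sub>R v\<close> lies in the kernel of \<open>p\<close>, the contracting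
  line. Adding a multiple of \<open>u\<close> to \<open>v\<close> removes this defect and gives the
  expanding component.\<close>

lemma hyperbolic_splitting:
  assumes A: "hyperbolic_matrix A" and v: "v \<notin> contracting_eigenline A"
  obtains m c w y where "v = w + y" "w \<noteq> 0" "\<bar>m\<bar> > 1" "real_matrix A *v w = m *\<^sub>R w"
    "\<bar>c\<bar> < 1" "real_matrix A *v y = c *\<^sub>R y"
proof -
  define M where "M = real_matrix A"
  obtain p :: "real^2 \<Rightarrow> real" and m :: real and u where
    lin: "linear p" and u: "contracting_eigenline A = span {u}" and m: "\<bar>m\<bar> > 1"
    and pM: "\<And>x. p (M *v x) = m * p x"
    and p0: "\<And>x. p x = 0 \<longleftrightarrow> x \<in> contracting_eigenline A"
    unfolding M_def by (rule hyperbolic_matrix_functional[OF A]) blast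
  have "u \<in> contracting_eigenline A" using u by (simp add: span_base)
  then obtain c where c: "\<bar>c\<bar> < 1" "M *v u = c *\<^sub>R u"
    by (auto simp: contracting_eigenline_def M_def)
  have "p (M *v v - m *\<^sub>R v) = 0" using lin by (simp add: linear_diff linear_scale pM)
  then obtain k where k: "M *v v - m *\<^sub>R v = k *\<^sub>R u"
    using p0 u by (auto simp: span_singleton)
  have mc: "m \<noteq> c" using m c by auto
  \<comment> \<open>Chosen to solve \<open>k + j * c = m * j\<close>, the condition for
    \<open>v + j *\<^sub>R u\<close> to have eigenvalue \<open>m\<close>.\<close>
  define j where "j = k / (m - c)"
  have j: "k + j * c = m * j" using mc by (simp add: j_def field_simps)
  have "M *v (v + j *\<^sub>R u) = m *\<^sub>R v + (k + j * c) *\<^sub>R u"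
    using k c(2) by (simp add: matrix_vector_right_distrib matrix_vector_mult_scaleR algebra_simps)
  then have ev: "M *v (v + j *\<^sub>R u) = m *\<^sub>R (v + j *\<^sub>R u)"
    by (simp add: j scaleR_right_distrib)
  have "v + j *\<^sub>R u \<noteq> 0"
  proof
    assume "v + j *\<^sub>R u = 0"
    then have "v = (- j) *\<^sub>R u" by (simp add: add_eq_0_iff2)
    then have "v \<in> span {u}" unfolding span_singleton by (rule range_eqI)
    then show False using v u by simp
  qed
  moreover have "M *v ((- j) *\<^sub>R u) = c *\<^sub>R ((- j) *\<^sub>R u)"
    unfolding matrix_vector_mult_scaleR c(2) by (simp add: mult.commute)
  moreover have "v = (v + j *\<^sub>R u) + (- j) *\<^sub>R u" by simp
  ultimately show ?thesis using that m ev c(1) unfolding M_def by blast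
qed

lemma funpow_eigenvector_sum:
  fixes M :: "real^'n^'n"
  assumes "M *v w = m *\<^sub>R w" "M *v y = c *\<^sub>R y"
  shows "((*v) M ^^ n) (t *\<^sub>R (w + y)) = (m ^ n * t) *\<^sub>R w + (c ^ n * t) *\<^sub>R y"
proof (induction n)
  case 0
  show ?case by (simp add: scaleR_right_distrib)
next
  case (Suc n)
  then show ?case
    by (simp add: matrix_vector_right_distrib matrix_vector_mult_scaleR assms mult_ac)
qed

text \<open>The \<open>n\<close>-th iterate of \<open>t *\<^sub>R (w + y)\<close> is
  \<open>(m ^ n * t) *\<^sub>R w + (c ^ n * t) *\<^sub>R y\<close>. For large \<open>n\<close> the
  first term sweeps a piece of the irrational line longer than \<open>R\<close> while
  \<open>t\<close> stays near \<open>t0\<close>, and the second is a small error.\<close>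

lemma transverse_segment_meets_open:
  assumes A: "hyperbolic_matrix A" and v: "v \<notin> contracting_eigenline A"
    and U: "open U" "U \<noteq> {}" and \<epsilon>: "\<epsilon> > 0"
  shows "\<exists>n t. \<bar>t - t0\<bar> < \<epsilon> \<and> (toral_map A ^^ n) (torus_proj (t *\<^sub>R v)) \<in> U"
proof -
  obtain m c w y where vwy: "v = w + y" and w: "w \<noteq> 0" "\<bar>m\<bar> > 1" "real_matrix A *v w = m *\<^sub>R w"
    and c: "\<bar>c\<bar> < 1" "real_matrix A *v y = c *\<^sub>R y"
    by (rule hyperbolic_splitting[OF A v])
  have irr: "irrational_direction w"
    using A w by (intro irrational_direction_eigenvector) (auto simp: hyperbolic_matrix_def)
  obtain q where "torus_proj q \<in> U" using U(2) torus.abs_induct[of "\<lambda>y. y \<notin> U"] by auto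
  moreover have "open (torus_proj -` U)" using U(1) by (simp add: open_torus_def)
  ultimately obtain e where e: "e > 0" "ball q e \<subseteq> torus_proj -` U"
    by (metis openE vimageI)
  \<comment> \<open>One half of \<open>e\<close> is for approximating \<open>q\<close> along the
    expanding line, the other for the contracting error.\<close>
  define \<delta> where "\<delta> = e / 2"
  have \<delta>: "\<delta> > 0" using e by (simp add: \<delta>_def)
  obtain R where R:
    "\<And>q s0. \<exists>s z. \<bar>s - s0\<bar> \<le> R \<and> (\<forall>i. z $ i \<in> \<int>) \<and> norm (s *\<^sub>R w - q - z) < \<delta>"
    by (rule irrational_line_relatively_dense[OF irr \<delta>]) blast
  \<comment> \<open>Bounds \<open>\<bar>t\<bar> * norm y\<close> for every \<open>t\<close> within
    \<epsilon> of \<open>t0\<close>, so that \<open>n\<close> can be fixed before \<open>t\<close>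
    is known.\<close>
  define C where "C = (\<bar>t0\<bar> + \<epsilon>) * norm y"
  have "(\<lambda>n. R * (1 / \<bar>m\<bar>) ^ n) \<longlonglongrightarrow> R * 0"
    using w(2) by (intro tendsto_intros LIMSEQ_power_zero) simp
  then have "\<forall>\<^sub>F n in sequentially. R * (1 / \<bar>m\<bar>) ^ n < \<epsilon>"
    by (rule order_tendstoD) (simp add: \<epsilon>)
  moreover have "(\<lambda>n. \<bar>c\<bar> ^ n * C) \<longlonglongrightarrow> 0 * C"
    using c(1) by (intro tendsto_intros LIMSEQ_power_zero) simp
  then have "\<forall>\<^sub>F n in sequentially. \<bar>c\<bar> ^ n * C < \<delta>"
    by (rule order_tendstoD) (simp add: \<delta>)
  ultimately have "\<forall>\<^sub>F n in sequentially. R * (1 / \<bar>m\<bar>) ^ n < \<epsilon> \<and> \<bar>c\<bar> ^ n * C < \<delta>"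
    by (rule eventually_conj)
  then obtain n where n: "R * (1 / \<bar>m\<bar>) ^ n < \<epsilon>" "\<bar>c\<bar> ^ n * C < \<delta>"
    by (auto simp: eventually_sequentially)
  obtain s z where s: "\<bar>s - m ^ n * t0\<bar> \<le> R" "\<forall>i. z $ i \<in> \<int>" "norm (s *\<^sub>R w - q - z) < \<delta>"
    using R by blast
  \<comment> \<open>The parameter whose expanding coordinate after \<open>n\<close> steps is exactly
    \<open>s\<close>.\<close>
  define t where "t = s / m ^ n"
  have mn: "\<bar>m\<bar> ^ n > 0" using w(2) by simp
  then have st: "m ^ n * t = s" by (auto simp: t_def)
  then have "\<bar>m\<bar> ^ n * \<bar>t - t0\<bar> \<le> R" using s(1)
    by (metis abs_mult power_abs right_diff_distrib)
  then have "\<bar>t - t0\<bar> \<le> R * (1 / \<bar>m\<bar>) ^ n"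
    using mn by (simp add: power_divide pos_le_divide_eq mult.commute)
  then have t: "\<bar>t - t0\<bar> < \<epsilon>" using n(1) by simp
  have "norm ((c ^ n * t) *\<^sub>R y) = \<bar>c\<bar> ^ n * (\<bar>t\<bar> * norm y)"
    by (simp add: abs_mult power_abs)
  also have "\<dots> \<le> \<bar>c\<bar> ^ n * C"
    unfolding C_def using t by (intro mult_left_mono mult_right_mono) auto
  finally have y: "norm ((c ^ n * t) *\<^sub>R y) < \<delta>" using n(2) by simp
  define x where "x = s *\<^sub>R w + (c ^ n * t) *\<^sub>R y"
  have "(toral_map A ^^ n) (torus_proj (t *\<^sub>R v)) = torus_proj x"
    by (simp add: toral_map_funpow vwy funpow_eigenvector_sum[OF w(3) c(2)] st x_def)
  also have "\<dots> = torus_proj (x - z)" using s(2) by (simp add: torus_proj_eq_iff)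
  also have "\<dots> \<in> U"
  proof -
    have "norm (x - z - q) \<le> norm (s *\<^sub>R w - q - z) + norm ((c ^ n * t) *\<^sub>R y)"
      by (rule order_trans[OF _ norm_triangle_ineq]) (simp add: x_def algebra_simps)
    also have "\<dots> < e" using s(3) y by (simp add: \<delta>_def)
    finally have "x - z \<in> ball q e" by (simp add: dist_norm norm_minus_commute)
    then show ?thesis using e(2) by auto
  qed
  finally show ?thesis using t by blast
qed

lemma continuous_torus_proj_funpow_line:
  "continuous_on UNIV (\<lambda>t::real. (toral_map A ^^ n) (torus_proj (t *\<^sub>R v)))"
proof -
  have "continuous_on UNIV ((*v) (real_matrix A) ^^ n)"
  proof (induction n)
    case 0
    show ?case by (simp add: id_def)
  next
    case (Suc n)
    then have "continuous_on UNIV (\<lambda>x. real_matrix A *v ((*v) (real_matrix A) ^^ n) x)"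
      by (rule bounded_linear.continuous_on[OF matrix_vector_mul_bounded_linear])
    then show ?case by (simp add: o_def)
  qed
  then have "continuous_on UNIV (\<lambda>t::real. ((*v) (real_matrix A) ^^ n) (t *\<^sub>R v))"
    by (rule continuous_on_compose2) (auto intro: continuous_on_scaleR continuous_on_id
        continuous_on_const)
  then show ?thesis unfolding toral_map_funpow
    by (rule continuous_on_compose2[OF continuous_torus_proj]) auto
qed

section \<open>Nondense orbits on the contracting eigenline\<close>

text \<open>The orbit together with its limit lifts to \<open>K\<close>, a compact countable set
  plus the lattice. \<open>K\<close> is closed, so the projected set is closed in the quotient
  topology, and it is countable, so that set is not the whole torus.\<close>

lemma contracting_eigenline_nondense:
  assumes "v \<in> contracting_eigenline A"
  shows "torus_proj v \<in> nondense_orbit_points (toral_map A)"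
proof -
  obtain c where c: "\<bar>c\<bar> < 1" "real_matrix A *v v = c *\<^sub>R v"
    using assms by (auto simp: contracting_eigenline_def)
  define f where "f n = c ^ n *\<^sub>R v" for n
  have orbit: "(toral_map A ^^ n) (torus_proj v) = torus_proj (f n)" for n
    \<comment> \<open>The second eigenvector is taken to be 0.\<close>
    using funpow_eigenvector_sum[OF c(2), of 0 0 n 1] by (simp add: toral_map_funpow f_def)
  have "f \<longlonglongrightarrow> 0 *\<^sub>R v" unfolding f_def
    using c(1) by (intro tendsto_intros LIMSEQ_power_zero) simp
  then have comp: "compact (insert 0 (range f))" by (simp add: compact_sequence_with_limit)
  let ?Z = "{z :: real^2. \<forall>i. z $ i \<in> \<int>}"
  have "closed ?Z"
  proof (rule discrete_imp_closed[of 1])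
    show "\<forall>x\<in>?Z. \<forall>y\<in>?Z. dist y x < 1 \<longrightarrow> y = x"
      by (auto simp: dist_norm dest!: integer_vector_small[rotated])
  qed simp
  define K where "K = (\<Union>x\<in>insert 0 (range f). \<Union>z\<in>?Z. {x + z})"
  have "closed K" unfolding K_def by (rule compact_closed_sums[OF comp \<open>closed ?Z\<close>])
  have "countable K" unfolding K_def
    by (intro countable_UN countable_insert countable_image countable_integer_vectors) auto
  have vim: "torus_proj -` torus_proj ` insert 0 (range f) = K"
  proof (intro equalityI subsetI)
    fix x assume "x \<in> torus_proj -` torus_proj ` insert 0 (range f)"
    then obtain y where y: "y \<in> insert 0 (range f)" "torus_proj x = torus_proj y" by auto
    then have "x - y \<in> ?Z" "x = y + (x - y)" by (simp_all add: torus_proj_eq_iff)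
    then show "x \<in> K" using y(1) unfolding K_def by blast
  next
    fix x assume "x \<in> K"
    then obtain y z where "y \<in> insert 0 (range f)" "z \<in> ?Z" "x = y + z"
      unfolding K_def by blast
    then have "torus_proj x = torus_proj y" by (simp add: torus_proj_eq_iff)
    then show "x \<in> torus_proj -` torus_proj ` insert 0 (range f)"
      using \<open>y \<in> insert 0 (range f)\<close> by blast
  qed
  have "open (- (torus_proj ` insert 0 (range f)))"
    unfolding open_torus_def vimage_Compl vim using \<open>closed K\<close> by (simp add: open_Compl)
  then have "closed (torus_proj ` insert 0 (range f))" by (simp add: closed_def)
  then have "closure (range (\<lambda>n. (toral_map A ^^ n) (torus_proj v)))
      \<subseteq> torus_proj ` insert 0 (range f)"
    by (intro closure_minimal) (auto simp: orbit)
  moreover have "K \<noteq> UNIV"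
    using \<open>countable K\<close> uncountable_ball[of 1 "0 :: real^2"]
    by (metis countable_subset subset_UNIV zero_less_one)
  then have "torus_proj ` insert 0 (range f) \<noteq> UNIV" using vim by auto
  ultimately show ?thesis unfolding nondense_orbit_points_def by blast
qed

section \<open>Baire category on the contracting eigenline\<close>

theorem corollary1p2:
  fixes T :: "torus \<Rightarrow> torus"
  assumes "hyperbolic_toral_automorphism T"
  shows "let X = nondense_orbit_points T \<inter>
      (\<Inter>S\<in>{S. hyperbolic_toral_automorphism S \<and>
                torus_dim (stable_manifold T \<inter> stable_manifold S) = 0}. dense_orbit_points S)
    in closure X = UNIV \<and> uncountable X"
proof -
  obtain A where A: "hyperbolic_matrix A" "T = toral_map A"
    using assms unfolding hyperbolic_toral_automorphism_def by blast
  obtain v where v0: "v \<noteq> 0" and v: "contracting_eigenline A = span {v}"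
    using hyperbolic_matrix_functional[OF A(1)] by metis
  define \<pi> where "\<pi> t = torus_proj (t *\<^sub>R v)" for t :: real
  have "v \<in> contracting_eigenline A" using v by (simp add: span_base)
  then obtain c where c: "\<bar>c\<bar> < 1" "real_matrix A *v v = c *\<^sub>R v"
    by (auto simp: contracting_eigenline_def)
  have irr: "irrational_direction v"
    using A(1) c v0 by (intro irrational_direction_eigenvector) (auto simp: hyperbolic_matrix_def)
  \<comment> \<open>Injectivity carries uncountability from parameters to points of the
    torus.\<close>
  have "inj \<pi>"
  proof (rule injI)
    fix s t assume "\<pi> s = \<pi> t"
    then have "\<forall>i. ((s - t) *\<^sub>R v) $ i \<in> \<int>"
      by (simp add: \<pi>_def torus_proj_eq_iff left_diff_distrib)
    then have "(s - t) *\<^sub>R v = 0" using irr unfolding irrational_direction_def by blast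
    then show "s = t" using v0 by simp
  qed
  \<comment> \<open>Indexing by integer matrices instead of maps makes countability of the family
    immediate.\<close>
  define \<F> where "\<F> = {B. hyperbolic_matrix B \<and> contracting_eigenline B \<noteq> contracting_eigenline A}"
  \<comment> \<open>Contracting eigenlines are one-dimensional, so sharing the nonzero
    \<open>v\<close> makes them equal.\<close>
  have trans: "v \<notin> contracting_eigenline B" if "B \<in> \<F>" for B
  proof
    assume vB: "v \<in> contracting_eigenline B"
    have B: "hyperbolic_matrix B" using that by (simp add: \<F>_def)
    obtain u where u: "contracting_eigenline B = span {u}"
      by (rule hyperbolic_matrix_functional[OF B])
    then obtain k where "v = k *\<^sub>R u" using vB by (auto simp: span_singleton)
    moreover from this have "k \<noteq> 0" using v0 by auto
    ultimately have "u = inverse k *\<^sub>R v" by simp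
    then have "u \<in> span {v}" unfolding span_singleton by (rule range_eqI)
    then have "span {u} = span {v}"
      using vB u by (simp add: span_minimal subset_antisym)
    then show False using that u v by (simp add: \<F>_def)
  qed
  obtain \<B> :: "(real^2) set set" where \<B>: "countable \<B>" "topological_basis \<B>"
    using ex_countable_basis by blast
  \<comment> \<open>Parameters in \<open>H B W\<close> for all nonempty \<open>W\<close> of the
    basis have a dense orbit under \<open>toral_map B\<close>, because every nonempty open set of
    the torus contains the projection of such a \<open>W\<close>.\<close>
  define H where "H B W = {t. \<exists>n. (toral_map B ^^ n) (\<pi> t) \<in> torus_proj ` W}" for B W
  define \<H> where "\<H> = (\<lambda>(B, W). H B W) ` (\<F> \<times> (\<B> - {{}}))"
  have "countable \<H>" unfolding \<H>_def using \<B>(1)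
    by (intro countable_image countable_SIGMA) auto
  have H: "open S \<and> closure S = UNIV" if S: "S \<in> \<H>" for S
  proof -
    obtain B W where BW: "B \<in> \<F>" "W \<in> \<B>" "W \<noteq> {}" "S = H B W"
      using S by (auto simp: \<H>_def)
    have W: "open (torus_proj ` W)" "torus_proj ` W \<noteq> {}"
      using BW \<B>(2) topological_basis_open by (auto intro: open_torus_proj_image)
    have "S = (\<Union>n. (\<lambda>t. (toral_map B ^^ n) (\<pi> t)) -` (torus_proj ` W))"
      by (auto simp: BW(4) H_def)
    moreover have "open ((\<lambda>t. (toral_map B ^^ n) (\<pi> t)) -` (torus_proj ` W))" for n
      using continuous_torus_proj_funpow_line W(1) unfolding \<pi>_def
      by (intro open_vimage) auto
    ultimately have "open S" by auto
    moreover have "t0 \<in> closure S" for t0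
    proof (unfold closure_approachable, intro allI impI)
      fix \<epsilon> :: real assume "\<epsilon> > 0"
      then obtain n t where "\<bar>t - t0\<bar> < \<epsilon>"
        "(toral_map B ^^ n) (torus_proj (t *\<^sub>R v)) \<in> torus_proj ` W"
        using transverse_segment_meets_open[OF _ trans[OF BW(1)] W] BW(1) unfolding \<F>_def by blast
      then show "\<exists>t\<in>S. dist t t0 < \<epsilon>"
        by (auto simp: BW(4) H_def \<pi>_def dist_real_def)
    qed
    ultimately show ?thesis by blast
  qed
  define G where "G = \<Inter>\<H>"
  \<comment> \<open>Deleting a countable set only adds countably many open dense sets to the
    intersection. The choice \<open>C = {}\<close> gives density of \<open>G\<close>; the choice
    \<open>C = G\<close> contradicts countability of \<open>G\<close>.\<close>
  have Gd: "closure (G - C) = UNIV" if "countable C" for C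
  proof -
    have "UNIV \<subseteq> closure (\<Inter>(\<H> \<union> (\<lambda>x. - {x}) ` C))"
    proof (rule Baire)
      show "countable (\<H> \<union> (\<lambda>x. - {x}) ` C)"
        using \<open>countable \<H>\<close> that by simp
      show "openin (top_of_set UNIV) S \<and> UNIV \<subseteq> closure S" if "S \<in> \<H> \<union> (\<lambda>x. - {x}) ` C" for S
        using that
      proof
        assume "S \<in> \<H>"
        then show ?thesis using H by simp
      next
        assume "S \<in> (\<lambda>x. - {x}) ` C"
        then show ?thesis by (auto simp: closure_complement)
      qed
    qed simp
    moreover have "\<Inter>(\<H> \<union> (\<lambda>x. - {x}) ` C) = G - C" by (auto simp: G_def)
    ultimately show ?thesis by auto
  qed
  have "uncountable G" using Gd[of G] by auto
  define X where "X = nondense_orbit_points T \<inter>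
      (\<Inter>S\<in>{S. hyperbolic_toral_automorphism S \<and>
                torus_dim (stable_manifold T \<inter> stable_manifold S) = 0}. dense_orbit_points S)"
  have sub: "\<pi> ` G \<subseteq> X"
  proof
    fix x assume "x \<in> \<pi> ` G"
    then obtain t where t: "t \<in> G" "x = \<pi> t" by blast
    have "t *\<^sub>R v \<in> contracting_eigenline A" using v by (simp add: span_base span_scale)
    then have "x \<in> nondense_orbit_points T"
      using contracting_eigenline_nondense A(2) t(2) by (simp add: \<pi>_def)
    moreover have "x \<in> dense_orbit_points S"
      if S: "hyperbolic_toral_automorphism S"
        "torus_dim (stable_manifold T \<inter> stable_manifold S) = 0" for S
    proof -
      obtain B where B: "hyperbolic_matrix B" "S = toral_map B"
        using S unfolding hyperbolic_toral_automorphism_def by blast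
      have "B \<in> \<F>"
        using torus_dim_stable_manifolds_iff[OF A(1) B(1)] S(2) A(2) B by (auto simp: \<F>_def)
      let ?O = "range (\<lambda>n. (S ^^ n) x)"
      have "y \<in> closure ?O" for y
      proof (unfold closure_iff_nhds_not_empty, intro allI impI)
        fix N U assume "U \<subseteq> N" "y \<in> U" "open U"
        obtain q where "y = torus_proj q"
          using torus.abs_induct[of "\<lambda>y. \<exists>q. y = torus_proj q" y] by auto
        then have "q \<in> torus_proj -` U" "open (torus_proj -` U)"
          using \<open>y \<in> U\<close> \<open>open U\<close> by (simp_all add: open_torus_def)
        then obtain W where W: "W \<in> \<B>" "q \<in> W" "W \<subseteq> torus_proj -` U"
          using topological_basisE[OF \<B>(2)] by metis
        then have "H B W \<in> \<H>" using \<open>B \<in> \<F>\<close> by (auto simp: \<H>_def)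
        then have "t \<in> H B W" using t(1) by (auto simp: G_def)
        then obtain n where "(S ^^ n) x \<in> torus_proj ` W"
          using t(2) B(2) by (auto simp: H_def)
        then have "(S ^^ n) x \<in> N" using W(3) \<open>U \<subseteq> N\<close> by auto
        then show "?O \<inter> N \<noteq> {}" by blast
      qed
      then show ?thesis by (auto simp: dense_orbit_points_def)
    qed
    ultimately show "x \<in> X" by (simp add: X_def)
  qed
  have "uncountable X"
  proof
    assume "countable X"
    then have "countable (\<pi> ` G)" using sub countable_subset by blast
    then show False
      using \<open>uncountable G\<close> countable_image_inj_on[of \<pi> G] \<open>inj \<pi>\<close> inj_on_subset by blast
  qed
  moreover have "y \<in> closure X" for y
  proof (unfold closure_iff_nhds_not_empty, intro allI impI)
    fix N U assume U: "U \<subseteq> N" "y \<in> U" "open U"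
    \<comment> \<open>Iterate 0 of the continuity lemma is \<pi> itself. The preimage of
      \<open>U\<close> is open and, by density of the line, nonempty, so the dense set
      \<open>G\<close> meets it.\<close>
    have "open (\<pi> -` U)"
      using continuous_torus_proj_funpow_line[where n = 0 and v = v] U(3) unfolding \<pi>_def
      by (intro open_vimage) auto
    moreover obtain s where "s \<in> \<pi> -` U"
      using irrational_line_meets_open[OF irr U(3)] U(2) by (auto simp: \<pi>_def)
    moreover have "s \<in> closure G" using Gd[of "{}"] by simp
    ultimately have "G \<inter> \<pi> -` U \<noteq> {}"
      by (meson closure_iff_nhds_not_empty subset_refl)
    then show "X \<inter> N \<noteq> {}" using sub U(1) by blast
  qed
  ultimately have "closure X = UNIV \<and> uncountable X" by blast
  then show ?thesis by (simp add: X_def Let_def)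
qed

end
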